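(* Let $h$ be an o-polynomial over $F=\mathbb{F}_{q}$, $q=2^m$, and let $i\in K=\mathbb{F}_{q^2}$ satisfy $i+i^q=1$. Define the oval $\mathcal{E}(h)$ in $PG(2,q)$, with nucleus $(1:0:0)$, by $$\mathcal{E}(h)=\{(t:h(t):1)\mid t\in F\}\cup\{(0:1:0)\}.$$ Then a function $g:S\to F$ corresponding to $\mathcal{E}(h)$ is given by $$g(u)=h^{-1}\!\left(\frac{\langle i,u\rangle}{\langle 1,u\rangle}\right)\langle 1,u\rangle+\langle i,u\rangle\quad (u\in S,\ u\neq 1),\qquad g(1)=1.$$ That is, for this $g$ the set $\{u/g(u)\mid u\in S\}$ is an oval in $PG(2,q)$ whose nucleus is the origin, and it is projectively equivalent to $\mathcal{E}(h)$.
   Context: $F=\mathbb{F}_{q}$ with $q=2^m$, $K=\mathbb{F}_{q^2}\supset F$, $\bar{x}=x^q$ for $x\in K$, $\langle x,y\rangle=x\bar{y}+\bar{x}y\in F$, and $S=\{u\in K: u\bar u=1\}$. Two models of $PG(2,q)$ are used: (i) the usual homogeneous triples $(x:y:z)$ over $F$; (ii) pairs $(x:z)$ with $x\in K$, $z\in F$, not both zero, up to multiplication by $F^*$. They are identified by $(x:y:z)\leftrightarrow(x+yi:z)$. In model (ii) the affine points are $(x:1)$, identified with $x\in K$, and the points at infinity are $u_\infty=(u:0)$, $u\in S$. The origin is $0\in K$. For $g:S\to F$ and $u\in S$, if $g(u)=0$ then $u/g(u)$ denotes the point at infinity $u_\infty$. An oval in $PG(2,q)$ is a set of $q+1$ points,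 no three collinear; all its tangent lines meet in one point, its nucleus. A hyperoval is a set of $q+2$ points, no three collinear. Two ovals (or hyperovals) are projectively equivalent if some element of $P\Gamma L(3,q)$ maps one to the other. An o-polynomial is a polynomial $h$ over $F$ with $h(0)=0$, $h(1)=1$ such that $\mathcal{D}(h)=\{(t:h(t):1)\mid t\in F\}\cup\{(1:0:0),(0:1:0)\}$ is a hyperoval; then $h$ permutes $F$ and $h^{-1}$ is the inverse permutation. A function $g:S\to F$ corresponds to an oval $\mathcal{E}$ if $\{u/g(u)\mid u\in S\}$ is an oval with nucleus at the origin that is projectively equivalent to $\mathcal{E}$. *)

theory Defs
  imports "HOL-Computational_Algebra.Polynomial"
begin

(* The field K is a finite field type 'k, and F is a subfield of it, given as a set of elements.
   The order q is always card F. *)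

definition is_subfield :: "'k::field set \<Rightarrow> bool" where
  "is_subfield F \<longleftrightarrow> 0 \<in> F \<and> 1 \<in> F \<and>
     (\<forall>x\<in>F. \<forall>y\<in>F. x + y \<in> F \<and> x - y \<in> F \<and> x * y \<in> F) \<and> (\<forall>x\<in>F. inverse x \<in> F)"

definition conjugate :: "'k::field set \<Rightarrow> 'k \<Rightarrow> 'k" where
  "conjugate F x = x ^ card F"

definition pairing :: "'k::field set \<Rightarrow> 'k \<Rightarrow> 'k \<Rightarrow> 'k" where
  "pairing F x y = x * conjugate F y + conjugate F x * y"

definition unit_circle :: "'k::field set \<Rightarrow> 'k set" where
  "unit_circle F = {u. u * conjugate F u = 1}"

(* (x:y:z), as the set of all nonzero F-multiples of the coordinate vector. *)
definition hpoint :: "'k::field set \<Rightarrow> 'k \<Rightarrow> 'k \<Rightarrow> 'k \<Rightarrow> ('k \<times> 'k \<times> 'k) set" where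
  "hpoint F x y z = {(c * x, c * y, c * z) | c. c \<in> F - {0}}"

definition PG_points :: "'k::field set \<Rightarrow> ('k \<times> 'k \<times> 'k) set set" where
  "PG_points F = {hpoint F x y z | x y z. x \<in> F \<and> y \<in> F \<and> z \<in> F \<and> (x, y, z) \<noteq> (0, 0, 0)}"

definition PG_line :: "'k::field set \<Rightarrow> 'k \<Rightarrow> 'k \<Rightarrow> 'k \<Rightarrow> ('k \<times> 'k \<times> 'k) set set" where
  "PG_line F a b c = {hpoint F x y z | x y z.
     x \<in> F \<and> y \<in> F \<and> z \<in> F \<and> (x, y, z) \<noteq> (0, 0, 0) \<and> a * x + b * y + c * z = 0}"

definition PG_lines :: "'k::field set \<Rightarrow> ('k \<times> 'k \<times> 'k) set set set" where
  "PG_lines F = {PG_line F a b c | a b c. a \<in> F \<and> b \<in> F \<and> c \<in> F \<and> (a, b, c) \<noteq> (0, 0, 0)}"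

definition no_three_collinear :: "'k::field set \<Rightarrow> ('k \<times> 'k \<times> 'k) set set \<Rightarrow> bool" where
  "no_three_collinear F X \<longleftrightarrow>
     (\<forall>P\<in>X. \<forall>Q\<in>X. \<forall>R\<in>X. P \<noteq> Q \<and> P \<noteq> R \<and> Q \<noteq> R \<longrightarrow>
        \<not> (\<exists>l\<in>PG_lines F. P \<in> l \<and> Q \<in> l \<and> R \<in> l))"

definition oval :: "'k::field set \<Rightarrow> ('k \<times> 'k \<times> 'k) set set \<Rightarrow> bool" where
  "oval F X \<longleftrightarrow> X \<subseteq> PG_points F \<and> card X = card F + 1 \<and> no_three_collinear F X"

definition hyperoval :: "'k::field set \<Rightarrow> ('k \<times> 'k \<times> 'k) set set \<Rightarrow> bool" where
  "hyperoval F X \<longleftrightarrow> X \<subseteq> PG_points F \<and> card X = card F + 2 \<and> no_three_collinear F X"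

definition tangents :: "'k::field set \<Rightarrow> ('k \<times> 'k \<times> 'k) set set \<Rightarrow> ('k \<times> 'k \<times> 'k) set set set" where
  "tangents F X = {l \<in> PG_lines F. card (X \<inter> l) = 1}"

definition has_nucleus ::
  "'k::field set \<Rightarrow> ('k \<times> 'k \<times> 'k) set set \<Rightarrow> ('k \<times> 'k \<times> 'k) set \<Rightarrow> bool" where
  "has_nucleus F X N \<longleftrightarrow> \<Inter> (tangents F X) = {N}"

definition field_automorphism :: "'k::field set \<Rightarrow> ('k \<Rightarrow> 'k) \<Rightarrow> bool" where
  "field_automorphism F \<sigma> \<longleftrightarrow> bij_betw \<sigma> F F \<and>
     (\<forall>x\<in>F. \<forall>y\<in>F. \<sigma> (x + y) = \<sigma> x + \<sigma> y \<and> \<sigma> (x * y) = \<sigma> x * \<sigma> y)"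

definition triple_add :: "'k::field \<times> 'k \<times> 'k \<Rightarrow> 'k \<times> 'k \<times> 'k \<Rightarrow> 'k \<times> 'k \<times> 'k" where
  "triple_add = (\<lambda>(x, y, z) (x', y', z'). (x + x', y + y', z + z'))"

definition triple_scale :: "'k::field \<Rightarrow> 'k \<times> 'k \<times> 'k \<Rightarrow> 'k \<times> 'k \<times> 'k" where
  "triple_scale c = (\<lambda>(x, y, z). (c * x, c * y, c * z))"

(* Invertible semilinear maps of the space of triples over F; the elements of the group PGammaL(3,q)
   are the maps on points (sets of triples) that they induce by taking images. *)
definition semilinear_bijection ::
  "'k::field set \<Rightarrow> ('k \<times> 'k \<times> 'k \<Rightarrow> 'k \<times> 'k \<times> 'k) \<Rightarrow> bool" where
  "semilinear_bijection F T \<longleftrightarrow> bij_betw T (F \<times> F \<times> F) (F \<times> F \<times> F) \<and>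
     (\<forall>v\<in>F \<times> F \<times> F. \<forall>w\<in>F \<times> F \<times> F. T (triple_add v w) = triple_add (T v) (T w)) \<and>
     (\<exists>\<sigma>. field_automorphism F \<sigma> \<and>
        (\<forall>c\<in>F. \<forall>v\<in>F \<times> F \<times> F. T (triple_scale c v) = triple_scale (\<sigma> c) (T v)))"

definition projectively_equivalent ::
  "'k::field set \<Rightarrow> ('k \<times> 'k \<times> 'k) set set \<Rightarrow> ('k \<times> 'k \<times> 'k) set set \<Rightarrow> bool" where
  "projectively_equivalent F X Y \<longleftrightarrow> (\<exists>T. semilinear_bijection F T \<and> (\<lambda>P. T ` P) ` X = Y)"

(* (x:z) with x in K and z in F, again as the set of all nonzero F-multiples. *)
definition kpoint :: "'k::field set \<Rightarrow> 'k \<Rightarrow> 'k \<Rightarrow> ('k \<times> 'k) set" where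
  "kpoint F x z = {(c * x, c * z) | c. c \<in> F - {0}}"

(* The identification (x:y:z) <-> (x+yi:z), read from right to left. *)
definition to_triples :: "'k::field set \<Rightarrow> 'k \<Rightarrow> ('k \<times> 'k) set \<Rightarrow> ('k \<times> 'k \<times> 'k) set" where
  "to_triples F i P = {(x, y, z). x \<in> F \<and> y \<in> F \<and> z \<in> F \<and> (x + y * i, z) \<in> P}"

definition origin :: "'k::field set \<Rightarrow> ('k \<times> 'k) set" where
  "origin F = kpoint F 0 1"

(* The point u/a, read as the point at infinity of u when a = 0. *)
definition quotient_point :: "'k::field set \<Rightarrow> 'k \<Rightarrow> 'k \<Rightarrow> ('k \<times> 'k) set" where
  "quotient_point F u a = (if a = 0 then kpoint F u 0 else kpoint F (u / a) 1)"

definition corresponds ::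
  "'k::field set \<Rightarrow> 'k \<Rightarrow> ('k \<Rightarrow> 'k) \<Rightarrow> ('k \<times> 'k \<times> 'k) set set \<Rightarrow> bool" where
  "corresponds F i g E \<longleftrightarrow> g ` unit_circle F \<subseteq> F \<and>
     (let X = to_triples F i ` {quotient_point F u (g u) | u. u \<in> unit_circle F}
      in oval F X \<and> has_nucleus F X (to_triples F i (origin F)) \<and> projectively_equivalent F X E)"

definition D_set :: "'k::field set \<Rightarrow> 'k poly \<Rightarrow> ('k \<times> 'k \<times> 'k) set set" where
  "D_set F h = {hpoint F t (poly h t) 1 | t. t \<in> F} \<union> {hpoint F 1 0 0, hpoint F 0 1 0}"

definition o_polynomial :: "'k::field set \<Rightarrow> 'k poly \<Rightarrow> bool" where
  "o_polynomial F h \<longleftrightarrow> (\<forall>n. coeff h n \<in> F) \<and> poly h 0 = 0 \<and> poly h 1 = 1 \<and> hyperoval F (D_set F h)"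

definition E_set :: "'k::field set \<Rightarrow> 'k poly \<Rightarrow> ('k \<times> 'k \<times> 'k) set set" where
  "E_set F h = {hpoint F t (poly h t) 1 | t. t \<in> F} \<union> {hpoint F 0 1 0}"

end

theory Submission
  imports Defs
begin

text \<open>
  Write \<open>u = a + b i\<close> with \<open>a, b \<in> F\<close>. In characteristic 2 one has \<open>\<langle>1, u\<rangle> = b\<close> and
  \<open>\<langle>i, u\<rangle> = a\<close>, so for \<open>u \<noteq> 1\<close> the point \<open>u / g(u)\<close> is
  \<open>(a : b : s b + a) = (h(s) : 1 : s + h(s))\<close> with \<open>h(s) = a / b\<close>. Every ratio \<open>a / b\<close> in \<open>F\<close>
  comes from an element of \<open>S\<close>, because squaring is a permutation of \<open>F\<close>. The linear map
  \<open>(x, y, z) \<mapsto> (x + z, x, y)\<close> therefore carries the point set of \<open>g\<close> onto \<open>\<E>(h)\<close> and the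
  origin to \<open>(1 : 0 : 0)\<close>. That \<open>(1 : 0 : 0)\<close> is the nucleus of \<open>\<E>(h)\<close> is a counting argument:
  the slopes of the secants through a fixed affine point are distinct and nonzero, so they
  exhaust the nonzero elements of \<open>F\<close>.
\<close>

section \<open>Finite subfields and points of the plane\<close>

locale finite_subfield =
  fixes F :: "'k::{field,finite} set"
  assumes subfield: "is_subfield F"
begin

lemma
  shows zero_mem [simp]: "0 \<in> F" and one_mem [simp]: "1 \<in> F"
    and add_mem [simp]: "x \<in> F \<Longrightarrow> y \<in> F \<Longrightarrow> x + y \<in> F"
    and diff_mem [simp]: "x \<in> F \<Longrightarrow> y \<in> F \<Longrightarrow> x - y \<in> F"
    and mult_mem [simp]: "x \<in> F \<Longrightarrow> y \<in> F \<Longrightarrow> x * y \<in> F"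
    and inverse_mem [simp]: "x \<in> F \<Longrightarrow> inverse x \<in> F"
  using subfield by (auto simp: is_subfield_def)

lemma uminus_mem [simp]: "x \<in> F \<Longrightarrow> - x \<in> F"
  using diff_mem[of 0 x] by simp

lemma divide_mem [simp]: "x \<in> F \<Longrightarrow> y \<in> F \<Longrightarrow> x / y \<in> F"
  by (simp add: divide_inverse)

lemma power_mem [simp]: "x \<in> F \<Longrightarrow> x ^ n \<in> F"
  by (induction n) auto

lemma sum_mem: "(\<And>j. j \<in> A \<Longrightarrow> f j \<in> F) \<Longrightarrow> sum f A \<in> F"
  by (induction A rule: infinite_finite_induct) auto

lemma poly_mem: "\<lbrakk>\<And>n. coeff p n \<in> F; x \<in> F\<rbrakk> \<Longrightarrow> poly p x \<in> F"
  by (simp add: poly_altdef sum_mem)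

lemma card_ge_2: "card F \<ge> 2"
proof -
  have "card {0, 1 :: 'k} \<le> card F"
    by (intro card_mono) auto
  then show ?thesis by simp
qed

text \<open>Multiplication by a nonzero \<open>x\<close> permutes the nonzero elements of
  \<open>F\<close>. Comparing their product before and after gives exponent
  \<open>card F - 1\<close>; one more factor \<open>x\<close> also covers
  \<open>x = 0\<close>.\<close>

lemma power_card_eq:
  assumes "x \<in> F" shows "x ^ card F = x"
proof (cases "x = 0")
  case True
  then show ?thesis using card_ge_2 by simp
next
  case False
  let ?U = "F - {0}"
  have inj: "inj_on ((*) x) ?U"
    using False by (auto intro: inj_onI)
  have img: "(*) x ` ?U = ?U"
    by (rule endo_inj_surj) (use inj False assms in auto)
  have "\<Prod>?U = (\<Prod>y\<in>?U. x * y)"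
    using prod.reindex[OF inj, of "\<lambda>y. y"] img by simp
  also have "\<dots> = x ^ card ?U * \<Prod>?U"
    by (simp add: prod.distrib)
  finally have "x ^ card ?U = 1"
    by simp
  moreover have "card F = Suc (card ?U)"
    by (rule card_Suc_Diff1[symmetric]) auto
  ultimately show ?thesis
    by (metis power_Suc mult.right_neutral)
qed

section \<open>Homogeneous coordinates and incidence\<close>

lemma hpoint_eq_iff:
  "hpoint F x y z = hpoint F x' y' z' \<longleftrightarrow> (\<exists>c\<in>F - {0}. x' = c * x \<and> y' = c * y \<and> z' = c * z)"
proof
  assume eq: "hpoint F x y z = hpoint F x' y' z'"
  have "(x', y', z') \<in> hpoint F x' y' z'"
    unfolding hpoint_def by (rule CollectI, rule exI[of _ 1]) auto
  then show "\<exists>c\<in>F - {0}. x' = c * x \<and> y' = c * y \<and> z' = c * z"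
    unfolding eq[symmetric] by (auto simp: hpoint_def)
next
  assume "\<exists>c\<in>F - {0}. x' = c * x \<and> y' = c * y \<and> z' = c * z"
  then obtain c where c: "c \<in> F" "c \<noteq> 0" "x' = c * x" "y' = c * y" "z' = c * z"
    by auto
  show "hpoint F x y z = hpoint F x' y' z'"
  proof (intro equalityI subsetI)
    fix p assume "p \<in> hpoint F x y z"
    then obtain d where "d \<in> F" "d \<noteq> 0" "p = (d * x, d * y, d * z)"
      by (auto simp: hpoint_def)
    then show "p \<in> hpoint F x' y' z'"
      using c unfolding hpoint_def by (auto intro!: exI[of _ "d / c"])
  next
    fix p assume "p \<in> hpoint F x' y' z'"
    then obtain d where "d \<in> F" "d \<noteq> 0" "p = (d * x', d * y', d * z')"
      by (auto simp: hpoint_def)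
    then show "p \<in> hpoint F x y z"
      using c unfolding hpoint_def by (auto intro!: exI[of _ "d * c"])
  qed
qed

lemma hpoint_scale: "c \<in> F \<Longrightarrow> c \<noteq> 0 \<Longrightarrow> hpoint F (c * x) (c * y) (c * z) = hpoint F x y z"
  using hpoint_eq_iff[of x y z "c * x" "c * y" "c * z"] by auto

text \<open>\<open>PG_line\<close> only asks for some representative that satisfies the equation.
  Representatives differ by a nonzero scalar and the equation is homogeneous, so any representative
  decides.\<close>

lemma hpoint_mem_line_iff:
  assumes "x \<in> F" "y \<in> F" "z \<in> F" "(x, y, z) \<noteq> (0, 0, 0)"
  shows "hpoint F x y z \<in> PG_line F a b c \<longleftrightarrow> a * x + b * y + c * z = 0"
proof
  assume "hpoint F x y z \<in> PG_line F a b c"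
  then obtain x' y' z' where "a * x' + b * y' + c * z' = 0" "hpoint F x y z = hpoint F x' y' z'"
    by (auto simp: PG_line_def)
  then obtain d where d: "d \<noteq> 0" "a * (d * x) + b * (d * y) + c * (d * z) = 0"
    by (auto simp: hpoint_eq_iff)
  then have "d * (a * x + b * y + c * z) = 0"
    by (simp add: algebra_simps)
  then show "a * x + b * y + c * z = 0"
    using d by simp
qed (use assms in \<open>auto simp: PG_line_def\<close>)

lemma line_mem_lines:
  "a \<in> F \<Longrightarrow> b \<in> F \<Longrightarrow> c \<in> F \<Longrightarrow> (a, b, c) \<noteq> (0, 0, 0) \<Longrightarrow> PG_line F a b c \<in> PG_lines F"
  by (auto simp: PG_lines_def)

end

section \<open>The oval of an o-polynomial\<close>

locale o_poly = finite_subfield F for F :: "'k::{field,finite} set" +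
  fixes h :: "'k poly"
  assumes o_polynomial: "o_polynomial F h"
begin

lemma h_mem [simp]: "t \<in> F \<Longrightarrow> poly h t \<in> F"
  using o_polynomial by (auto simp: o_polynomial_def intro: poly_mem)

lemma h_0: "poly h 0 = 0"
  using o_polynomial by (simp add: o_polynomial_def)

text \<open>The hyperoval property in terms of line coefficients: a contradiction is obtained by
  naming three points and an equation they satisfy.\<close>

lemma D_set_noncollinear:
  assumes "P \<in> D_set F h" "Q \<in> D_set F h" "R \<in> D_set F h" "P \<noteq> Q" "P \<noteq> R" "Q \<noteq> R"
    and "a \<in> F" "b \<in> F" "c \<in> F" "(a, b, c) \<noteq> (0, 0, 0)"
    and "P \<in> PG_line F a b c" "Q \<in> PG_line F a b c" "R \<in> PG_line F a b c"
  shows False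
  using assms o_polynomial line_mem_lines[of a b c]
  unfolding o_polynomial_def hyperoval_def no_three_collinear_def by blast

lemma D_set_eq: "D_set F h = insert (hpoint F 1 0 0) (E_set F h)"
  by (auto simp: D_set_def E_set_def)

lemma E_set_subset: "E_set F h \<subseteq> D_set F h"
  by (auto simp: D_set_eq)

lemma affine_mem_E: "t \<in> F \<Longrightarrow> hpoint F t (poly h t) 1 \<in> E_set F h"
  by (auto simp: E_set_def)

lemma affine_eq_iff: "hpoint F t y 1 = hpoint F t' y' 1 \<longleftrightarrow> t = t' \<and> y = y'"
  by (auto simp: hpoint_eq_iff)

text \<open>Non-collinearity is inherited from the hyperoval. Listing the points bounds the size by
  \<open>card F + 1\<close>; adding the single point (1:0:0) must give \<open>card F + 2\<close>, so
  the bound is attained.\<close>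

lemma oval_E_set: "oval F (E_set F h)"
proof -
  have D: "D_set F h \<subseteq> PG_points F" "card (D_set F h) = card F + 2" "no_three_collinear F (D_set F h)"
    using o_polynomial by (auto simp: o_polynomial_def hyperoval_def)
  have card_insert: "card (insert P A) \<le> card A + 1" for P and A :: "('k \<times> 'k \<times> 'k) set set"
    by (cases "P \<in> A") (simp_all add: insert_absorb)
  have E: "E_set F h = insert (hpoint F 0 1 0) ((\<lambda>t. hpoint F t (poly h t) 1) ` F)"
    by (simp add: E_set_def Setcompr_eq_image)
  have "card (E_set F h) \<le> card ((\<lambda>t. hpoint F t (poly h t) 1) ` F) + 1"
    unfolding E by (rule card_insert)
  also have "\<dots> \<le> card F + 1"
    by (intro add_right_mono card_image_le finite)
  finally have le: "card (E_set F h) \<le> card F + 1" .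
  have "card (D_set F h) \<le> card (E_set F h) + 1"
    unfolding D_set_eq by (rule card_insert)
  with le D(2) have "card (E_set F h) = card F + 1"
    by linarith
  moreover have "no_three_collinear F (E_set F h)"
    using D(3) E_set_subset unfolding no_three_collinear_def by (meson subsetD)
  moreover have "E_set F h \<subseteq> PG_points F"
    using D(1) E_set_subset by (rule order_trans[rotated])
  ultimately show ?thesis
    by (simp add: oval_def)
qed

text \<open>If \<open>h\<close> took one value at \<open>s\<close> and \<open>t\<close>, the
  horizontal line at that height would contain both affine points and also (1:0:0).\<close>

lemma inj_h: "inj_on (poly h) F"
proof (rule inj_onI, rule ccontr)
  fix s t assume st: "s \<in> F" "t \<in> F" "poly h s = poly h t" "s \<noteq> t"
  show False
    by (rule D_set_noncollinear[of "hpoint F s (poly h s) 1" "hpoint F t (poly h t) 1"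
          "hpoint F 1 0 0" 0 1 "- poly h s"])
      (use st in \<open>auto simp: D_set_def affine_eq_iff hpoint_mem_line_iff hpoint_eq_iff\<close>)
qed

lemma bij_h: "bij_betw (poly h) F F"
  by (simp add: bij_betw_def inj_h endo_inj_surj image_subset_iff)

text \<open>Two secants through the point over \<open>t\<close> with equal slope would be one line
  with three points, and slope 0 contradicts injectivity of \<open>h\<close>. So the slopes are
  \<open>card F - 1\<close> distinct nonzero elements of \<open>F\<close>, hence all of
  them.\<close>

lemma secant_slope_exists:
  assumes "t \<in> F" "k \<in> F" "k \<noteq> 0"
  obtains s where "s \<in> F" "s \<noteq> t" "poly h s - poly h t = k * (s - t)"
proof -
  let ?f = "\<lambda>s. (poly h s - poly h t) / (s - t)"
  have inj: "inj_on ?f (F - {t})"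
  proof (rule inj_onI, rule ccontr)
    fix r s assume rs: "r \<in> F - {t}" "s \<in> F - {t}" "?f r = ?f s" "r \<noteq> s"
    define l where "l = ?f r"
    have "l \<in> F" "poly h r = poly h t + l * (r - t)"
      using rs(1,2) assms(1) by (simp_all add: l_def)
    moreover have "l = ?f s"
      using rs(3) by (simp add: l_def)
    then have "poly h s = poly h t + l * (s - t)"
      using rs(1,2) by simp
    ultimately have l: "l \<in> F" "poly h r = poly h t + l * (r - t)" "poly h s = poly h t + l * (s - t)"
      by blast+
    show False
      \<comment> \<open>The coefficients describe the line of slope \<open>l\<close> through the
        point over \<open>t\<close>.\<close>
      by (rule D_set_noncollinear[of "hpoint F r (poly h r) 1" "hpoint F s (poly h s) 1"
          "hpoint F t (poly h t) 1" l "- 1" "poly h t - l * t"])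
        (use rs assms(1) l in \<open>auto simp: D_set_def affine_eq_iff hpoint_mem_line_iff algebra_simps\<close>)
  qed
  have "?f ` (F - {t}) \<subseteq> F - {0}"
    using assms(1) inj_onD[OF inj_h] by auto
  moreover have "card (?f ` (F - {t})) = card (F - {0})"
    using assms(1) by (simp add: card_image[OF inj])
  ultimately have "?f ` (F - {t}) = F - {0}"
    by (intro card_subset_eq) auto
  then obtain s where "s \<in> F" "s \<noteq> t" "?f s = k"
    using assms by (metis (no_types, lifting) Diff_iff imageE singletonD singletonI)
  then show ?thesis
    by (intro that[of s]) auto
qed

text \<open>The line passes through (1:0:0) exactly when \<open>a = 0\<close>. For
  \<open>a \<noteq> 0\<close> a second point of the oval on the line contradicts tangency.\<close>

lemma tangent_contains_nucleus:
  assumes "l \<in> tangents F (E_set F h)" shows "hpoint F 1 0 0 \<in> l"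
proof -
  obtain a b c where l: "l = PG_line F a b c" "a \<in> F" "b \<in> F" "c \<in> F"
    using assms by (auto simp: tangents_def PG_lines_def)
  have "card (E_set F h \<inter> l) = 1"
    using assms by (auto simp: tangents_def)
  then obtain P where P: "E_set F h \<inter> l = {P}"
    by (auto simp: card_1_singleton_iff)
  have unique: "Q = R" if "Q \<in> E_set F h" "R \<in> E_set F h" "Q \<in> l" "R \<in> l" for Q R
    using P that by (metis Int_iff singletonD)
  have "a = 0"
  proof (rule ccontr)
    assume a: "a \<noteq> 0"
    show False
    proof (cases "b = 0")
      case True
      \<comment> \<open>The line is vertical: it contains (0:1:0) and the affine point over this
        \<open>?t\<close>.\<close>
      let ?t = "- c / a"
      have "hpoint F 0 1 0 = hpoint F ?t (poly h ?t) 1"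
        by (rule unique) (use True a l in \<open>auto simp: E_set_def hpoint_mem_line_iff\<close>)
      then show False
        by (simp add: hpoint_eq_iff)
    next
      case False
      have "hpoint F 0 1 0 \<notin> l"
        using l False by (simp add: hpoint_mem_line_iff)
      moreover have "P \<in> E_set F h" "P \<in> l"
        using P by auto
      ultimately obtain t where t: "t \<in> F" "P = hpoint F t (poly h t) 1"
        by (auto simp: E_set_def)
      have on_l: "a * t + b * poly h t + c = 0"
        using \<open>P \<in> l\<close> t l by (simp add: hpoint_mem_line_iff)
      \<comment> \<open>The line has nonzero slope \<open>- a / b\<close>, which is also the slope
        of a secant through \<open>P\<close>; so the line is that secant.\<close>
      obtain s where s: "s \<in> F" "s \<noteq> t" "poly h s - poly h t = (- a / b) * (s - t)"
        by (rule secant_slope_exists[of t "- a / b"]) (use t a False l in auto)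
      have "b * (poly h s - poly h t) = - a * (s - t)"
        using False unfolding s(3) by simp
      then have "a * s + b * poly h s + c = a * t + b * poly h t + c"
        by (simp add: algebra_simps add_eq_0_iff2 eq_neg_iff_add_eq_0)
      then have "hpoint F s (poly h s) 1 \<in> l"
        using on_l s l by (simp add: hpoint_mem_line_iff)
      then have "hpoint F s (poly h s) 1 = P"
        using t by (intro unique) (use s \<open>P \<in> l\<close> in \<open>auto intro: affine_mem_E\<close>)
      then show False
        using s t by (simp add: affine_eq_iff)
    qed
  qed
  then show ?thesis
    using l by (simp add: hpoint_mem_line_iff)
qed

text \<open>It remains to find two tangents that meet only in (1:0:0): the line
  \<open>y = 0\<close>, which touches at (0:0:1) because \<open>h\<close> vanishes only at 0, and
  the line \<open>z = 0\<close>, which touches at (0:1:0).\<close>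

lemma has_nucleus_E_set: "has_nucleus F (E_set F h) (hpoint F 1 0 0)"
  unfolding has_nucleus_def
proof (intro equalityI subsetI)
  fix P assume P: "P \<in> \<Inter> (tangents F (E_set F h))"
  have "E_set F h \<inter> PG_line F 0 1 0 = {hpoint F 0 0 1}"
  proof (intro equalityI subsetI)
    fix Q assume "Q \<in> E_set F h \<inter> PG_line F 0 1 0"
    then obtain t where "t \<in> F" "Q = hpoint F t (poly h t) 1" "poly h t = 0"
      by (auto simp: E_set_def hpoint_mem_line_iff)
    moreover from this have "t = 0"
      using inj_onD[OF inj_h, of t 0] by (simp add: h_0)
    ultimately show "Q \<in> {hpoint F 0 0 1}"
      by (simp add: h_0)
  next
    fix Q assume "Q \<in> {hpoint F 0 0 1}"
    then show "Q \<in> E_set F h \<inter> PG_line F 0 1 0"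
      using affine_mem_E[of 0] by (simp add: h_0 hpoint_mem_line_iff)
  qed
  then have "PG_line F 0 1 0 \<in> tangents F (E_set F h)"
    by (simp add: tangents_def line_mem_lines)
  moreover have "E_set F h \<inter> PG_line F 0 0 1 = {hpoint F 0 1 0}"
    by (auto simp: E_set_def hpoint_mem_line_iff)
  then have "PG_line F 0 0 1 \<in> tangents F (E_set F h)"
    by (simp add: tangents_def line_mem_lines)
  ultimately have P: "P \<in> PG_line F 0 1 0" "P \<in> PG_line F 0 0 1"
    using P by auto
  then obtain x y z where xyz: "x \<in> F" "y \<in> F" "z \<in> F" "(x, y, z) \<noteq> (0, 0, 0)" "P = hpoint F x y z"
    unfolding PG_line_def by blast
  then have "y = 0" "z = 0" "x \<noteq> 0"
    using P by (auto simp: hpoint_mem_line_iff)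
  then show "P \<in> {hpoint F 1 0 0}"
    using xyz hpoint_scale[of x 1 0 0] by simp
qed (use tangent_contains_nucleus in auto)

end

section \<open>Transport along collineations\<close>

lemma
  assumes inj: "inj \<Phi>" and points: "\<Phi> ` PG_points F = PG_points F"
    and lines: "(`) \<Phi> ` PG_lines F = PG_lines F"
  shows oval_collineation_iff: "oval F (\<Phi> ` X) \<longleftrightarrow> oval F X"
    and has_nucleus_collineation: "has_nucleus F (\<Phi> ` X) (\<Phi> N) \<Longrightarrow> has_nucleus F X N"
proof -
  \<comment> \<open>Every line is the image of a line, so quantification over lines can be pulled
    back along \<open>\<Phi>\<close>.\<close>
  have lines_iff: "(\<exists>l\<in>PG_lines F. Q l) \<longleftrightarrow> (\<exists>l\<in>PG_lines F. Q (\<Phi> ` l))" for Q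
    by (subst lines[symmetric]) blast
  have "\<Phi> ` X \<subseteq> PG_points F \<longleftrightarrow> X \<subseteq> PG_points F"
    by (subst points[symmetric]) (rule inj_image_subset_iff[OF inj])
  moreover have "card (\<Phi> ` X) = card X"
    by (meson card_image inj inj_on_subset subset_UNIV)
  moreover have "no_three_collinear F (\<Phi> ` X) \<longleftrightarrow> no_three_collinear F X"
    unfolding no_three_collinear_def
    by (subst lines_iff) (simp add: inj_image_mem_iff[OF inj] inj_eq[OF inj])
  ultimately show "oval F (\<Phi> ` X) \<longleftrightarrow> oval F X"
    by (simp add: oval_def)
  assume nuc: "has_nucleus F (\<Phi> ` X) (\<Phi> N)"
  have "card (\<Phi> ` X \<inter> \<Phi> ` l) = card (X \<inter> l)" for l
    by (metis image_Int[OF inj] card_image inj inj_on_subset subset_UNIV)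
  then have tan: "tangents F (\<Phi> ` X) = (`) \<Phi> ` tangents F X"
    unfolding tangents_def by (subst lines[symmetric]) auto
  have "P \<in> \<Inter> (tangents F X) \<longleftrightarrow> \<Phi> P \<in> \<Inter> (tangents F (\<Phi> ` X))" for P
    unfolding tan by (auto simp: inj_image_mem_iff[OF inj])
  then have "P \<in> \<Inter> (tangents F X) \<longleftrightarrow> P = N" for P
    using nuc unfolding has_nucleus_def by (simp only: singleton_iff inj_eq[OF inj])
  then show "has_nucleus F X N"
    unfolding has_nucleus_def by (intro set_eqI) (simp only: singleton_iff)
qed

definition shear :: "'k::field \<times> 'k \<times> 'k \<Rightarrow> 'k \<times> 'k \<times> 'k" where
  "shear = (\<lambda>(x, y, z). (x + z, x, y))"

lemma shear_simp [simp]: "shear (x, y, z) = (x + z, x, y)"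
  by (simp add: shear_def)

lemma inj_image_shear: "inj ((`) (shear :: 'k::field \<times> 'k \<times> 'k \<Rightarrow> _))"
proof -
  have "inj (shear :: 'k \<times> 'k \<times> 'k \<Rightarrow> _)"
    by (auto intro!: injI)
  then show ?thesis
    by (rule inj_image_eq_iff[THEN iffD1, THEN injI])
qed

context finite_subfield
begin

lemma shear_hpoint [simp]: "shear ` hpoint F x y z = hpoint F (x + z) x y"
proof -
  have "hpoint F x y z = (\<lambda>c. (c * x, c * y, c * z)) ` (F - {0})" for x y z
    by (auto simp: hpoint_def)
  then show ?thesis
    by (simp add: image_image algebra_simps)
qed

text \<open>The new coefficients arise by substituting the inverse map
  \<open>(x, y, z) \<mapsto> (y, z, x - y)\<close> into
  \<open>a * x + b * y + c * z\<close>.\<close>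

lemma shear_line: "(`) shear ` PG_line F a b c = PG_line F c (a - c) b"
proof (intro equalityI subsetI)
  fix P assume "P \<in> (`) shear ` PG_line F a b c"
  then obtain x y z where "x \<in> F" "y \<in> F" "z \<in> F" "(x, y, z) \<noteq> (0, 0, 0)"
      "a * x + b * y + c * z = 0" "P = hpoint F (x + z) x y"
    by (auto simp: PG_line_def)
  then show "P \<in> PG_line F c (a - c) b"
    by (auto simp: hpoint_mem_line_iff algebra_simps)
next
  fix P assume "P \<in> PG_line F c (a - c) b"
  then obtain x y z where "x \<in> F" "y \<in> F" "z \<in> F" "(x, y, z) \<noteq> (0, 0, 0)"
      "c * x + (a - c) * y + b * z = 0" "P = hpoint F x y z"
    by (auto simp: PG_line_def)
  then have "hpoint F y z (x - y) \<in> PG_line F a b c" "P = shear ` hpoint F y z (x - y)"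
    by (auto simp: hpoint_mem_line_iff algebra_simps)
  then show "P \<in> (`) shear ` PG_line F a b c"
    by blast
qed

lemma shear_points: "(`) shear ` PG_points F = PG_points F"
proof -
  \<comment> \<open>With all coefficients zero the equation is vacuous, so the line formula also
    covers the whole plane.\<close>
  have "PG_points F = PG_line F 0 0 0"
    by (auto simp: PG_points_def PG_line_def)
  then show ?thesis
    by (simp add: shear_line)
qed

lemma shear_lines: "(`) ((`) shear) ` PG_lines F = PG_lines F"
proof (intro equalityI subsetI)
  fix l assume "l \<in> PG_lines F"
  then obtain a b c where "a \<in> F" "b \<in> F" "c \<in> F" "(a, b, c) \<noteq> (0, 0, 0)" "l = PG_line F a b c"
    by (auto simp: PG_lines_def)
  \<comment> \<open>These coefficients solve \<open>c' = a\<close>, \<open>a' - c' = b\<close>,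
    \<open>b' = c\<close> for the preimage of the line.\<close>
  then have "PG_line F (b + a) c a \<in> PG_lines F" "l = (`) shear ` PG_line F (b + a) c a"
    by (auto simp: shear_line intro!: line_mem_lines)
  then show "l \<in> (`) ((`) shear) ` PG_lines F"
    by blast
next
  fix l assume "l \<in> (`) ((`) shear) ` PG_lines F"
  then obtain a b c where "a \<in> F" "b \<in> F" "c \<in> F" "(a, b, c) \<noteq> (0, 0, 0)"
      "l = PG_line F c (a - c) b"
    by (auto simp: PG_lines_def shear_line)
  then show "l \<in> PG_lines F"
    by (auto intro!: line_mem_lines)
qed

lemma semilinear_bijection_shear: "semilinear_bijection F shear"
  unfolding semilinear_bijection_def
proof (intro conjI exI[of _ "\<lambda>x. x"])
  show "bij_betw shear (F \<times> F \<times> F) (F \<times> F \<times> F)"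
    by (rule bij_betw_byWitness[where f' = "\<lambda>(x, y, z). (y, z, x - y)"]) auto
  show "field_automorphism F (\<lambda>x. x)"
    by (simp add: field_automorphism_def bij_betw_def)
qed (auto simp: triple_add_def triple_scale_def algebra_simps)

end

section \<open>The quadratic extension\<close>

locale even_quadratic_extension = finite_subfield F for F :: "'k::{field,finite} set" +
  fixes m :: nat and i :: 'k
  assumes card_F: "card F = 2 ^ m"
    and card_UNIV: "card (UNIV :: 'k set) = card F ^ 2"
    and trace_i: "i + i ^ card F = 1"
begin

text \<open>Raising -1 to the power \<open>card F\<close> returns -1, but the exponent is even, so
  the result is also 1.\<close>

lemma two_eq_0: "(2 :: 'k) = 0"
proof -
  have "even (card F)"
    using card_ge_2 card_F by (cases m) auto
  then have "(- 1 :: 'k) = 1"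
    using power_card_eq[of "- 1"] by simp
  then have "1 + 1 = (0 :: 'k)"
    by (metis add.right_inverse)
  then show ?thesis
    by simp
qed

lemma add_self [simp]: "(x :: 'k) + x = 0"
  using two_eq_0 by (metis mult_2 mult_zero_left)

lemma uminus_eq [simp]: "- (x :: 'k) = x"
  by (rule minus_unique) simp

lemma minus_eq [simp]: "(x :: 'k) - y = x + y"
  by (simp add: diff_conv_add_uminus del: add_uminus_conv_diff)

lemma add_left_cancel_self [simp]: "(x :: 'k) + (x + y) = y"
  by (simp flip: add.assoc)

text \<open>Conjugation is \<open>m\<close>-fold squaring, and squaring is additive in
  characteristic 2.\<close>

lemma conjugate_add: "conjugate F (x + y) = conjugate F x + conjugate F y"
proof -
  have "(x + y) ^ 2 ^ n = x ^ 2 ^ n + y ^ 2 ^ n" for n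
    by (induction n)
      (simp_all add: power_mult power2_sum two_eq_0 mult.commute[of 2])
  then show ?thesis
    by (simp add: conjugate_def card_F)
qed

lemma conjugate_mult: "conjugate F (x * y) = conjugate F x * conjugate F y"
  by (simp add: conjugate_def power_mult_distrib)

lemma conjugate_mem [simp]: "x \<in> F \<Longrightarrow> conjugate F x = x"
  by (simp add: conjugate_def power_card_eq)

lemma conjugate_i: "conjugate F i = 1 + i"
  using trace_i unfolding conjugate_def by (metis add_left_cancel_self add.commute)

lemma i_notin: "i \<notin> F"
  using conjugate_i conjugate_mem[of i] by auto

text \<open>Linear independence of 1 and \<open>i\<close> over \<open>F\<close>: otherwise
  \<open>i\<close> would be a quotient of elements of \<open>F\<close>.\<close>

lemma basis_eq_iff:
  assumes "a \<in> F" "b \<in> F" "a' \<in> F" "b' \<in> F"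
  shows "a + b * i = a' + b' * i \<longleftrightarrow> a = a' \<and> b = b'"
proof
  assume eq: "a + b * i = a' + b' * i"
  have "b = b'"
  proof (rule ccontr)
    assume "b \<noteq> b'"
    have "b + b' \<noteq> 0"
      using \<open>b \<noteq> b'\<close> by (metis minus_eq right_minus_eq)
    moreover have "(b + b') * i = a + a'"
      using eq by (simp add: distrib_right) (metis add.commute add.assoc add_left_cancel_self)
    ultimately have "i = (a + a') / (b + b')"
      by (simp add: field_simps)
    then show False
      using i_notin assms by auto
  qed
  then show "a = a' \<and> b = b'"
    using eq by simp
qed auto

text \<open>By independence the combinations are \<open>card F ^ 2\<close> distinct elements, which
  is the size of the whole field.\<close>

lemma basis_decomposition:
  obtains a b where "a \<in> F" "b \<in> F" "u = a + b * i"
proof -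
  let ?f = "\<lambda>(a, b). a + b * i"
  have "inj_on ?f (F \<times> F)"
    by (auto intro!: inj_onI simp: basis_eq_iff)
  then have "card (?f ` (F \<times> F)) = card (UNIV :: 'k set)"
    by (simp add: card_image card_cartesian_product card_UNIV power2_eq_square)
  then have "?f ` (F \<times> F) = UNIV"
    by (intro card_subset_eq) auto
  then have "u \<in> ?f ` (F \<times> F)"
    by simp
  then show ?thesis
    using that by auto
qed

section \<open>Conjugation, the pairing and the unit circle in the basis 1, \<open>i\<close>\<close>

lemma conjugate_basis: "a \<in> F \<Longrightarrow> b \<in> F \<Longrightarrow> conjugate F (a + b * i) = (a + b) + b * i"
  by (simp add: conjugate_add conjugate_mult conjugate_i algebra_simps)

text \<open>In the second identity \<open>i * i\<close> occurs twice with the same coefficient and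
  cancels.\<close>

lemma pairing_basis:
  assumes "a \<in> F" "b \<in> F"
  shows "pairing F 1 (a + b * i) = b" "pairing F i (a + b * i) = a"
  using assms by (simp_all add: pairing_def conjugate_basis conjugate_i algebra_simps)

lemma conjugate_fixed_mem:
  assumes "conjugate F x = x" shows "x \<in> F"
proof -
  obtain a b where ab: "a \<in> F" "b \<in> F" "x = a + b * i"
    by (rule basis_decomposition)
  then have "a + b = a"
    using assms by (simp add: conjugate_basis basis_eq_iff)
  then show ?thesis
    using ab by simp
qed

text \<open>Squaring is injective in characteristic 2, hence surjective on the finite set
  \<open>F\<close>.\<close>

lemma square_root_exists:
  assumes "x \<in> F" obtains y where "y \<in> F" "y * y = x"
proof -
  have "inj_on (\<lambda>y. y * y) F"
  proof (rule inj_onI)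
    fix x y :: 'k assume "x * x = y * y"
    then have "(x + y) * (x + y) = 0"
      by (simp add: algebra_simps)
    then show "x = y"
      by (metis mult_eq_0_iff minus_eq right_minus_eq)
  qed
  then have "(\<lambda>y. y * y) ` F = F"
    by (intro endo_inj_surj) auto
  then show ?thesis
    using assms that by (metis (no_types, lifting) imageE)
qed

lemma unit_circle_mem_F:
  assumes "u \<in> unit_circle F" "u \<in> F" shows "u = 1"
proof -
  have "(u + 1) * (u + 1) = 0"
    using assms by (simp add: unit_circle_def algebra_simps)
  then show ?thesis
    by (metis mult_eq_0_iff minus_eq right_minus_eq)
qed

text \<open>The norm \<open>N\<close> of \<open>r + i\<close> is a nonzero element of
  \<open>F\<close>; scaling \<open>r + i\<close> by a square root of \<open>inverse N\<close> makes
  the norm 1 and keeps the ratio of coordinates.\<close>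

lemma unit_circle_ratio_exists:
  assumes "r \<in> F"
  obtains b where "b \<in> F" "b \<noteq> 0" "b * r + b * i \<in> unit_circle F"
proof -
  define N where "N = (r + i) * conjugate F (r + i)"
  have conj: "conjugate F (r + i) = r + 1 + i"
    using conjugate_basis[of r 1] assms by simp
  \<comment> \<open>Conjugation swaps the two factors \<open>r + i\<close> and
    \<open>r + 1 + i\<close> of \<open>N\<close>.\<close>
  have "conjugate F N = N"
    unfolding N_def conj conjugate_mult using conjugate_basis[of "r + 1" 1] assms
    by (simp add: conj add.commute add.left_commute mult.commute)
  then have "N \<in> F"
    by (rule conjugate_fixed_mem)
  have "r + i \<noteq> 0" "r + 1 + i \<noteq> 0"
    using basis_eq_iff[of _ 1 0 0] assms by auto
  then have "N \<noteq> 0"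
    by (simp add: N_def conj)
  obtain b where b: "b \<in> F" "b * b = inverse N"
    using square_root_exists[of "inverse N"] \<open>N \<in> F\<close> by auto
  have "(b * (r + i)) * conjugate F (b * (r + i)) = (b * b) * N"
    unfolding N_def conjugate_mult conjugate_mem[OF b(1)] by (simp only: mult_ac)
  also have "\<dots> = 1"
    using b \<open>N \<noteq> 0\<close> by simp
  finally have "b * r + b * i \<in> unit_circle F"
    by (simp add: unit_circle_def distrib_left)
  moreover have "b \<noteq> 0"
    using b \<open>N \<noteq> 0\<close> by auto
  ultimately show ?thesis
    using that b by blast
qed

section \<open>Passing between the two models of the plane\<close>

lemma to_triples_kpoint:
  assumes "a \<in> F" "b \<in> F" "z \<in> F"
  shows "to_triples F i (kpoint F (a + b * i) z) = hpoint F a b z"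
proof -
  have coords: "x + y * i = c * (a + b * i) \<longleftrightarrow> x = c * a \<and> y = c * b"
    if "c \<in> F" "x \<in> F" "y \<in> F" for c x y
    using basis_eq_iff[of x y "c * a" "c * b"] that assms by (simp add: algebra_simps)
  show ?thesis
  proof (intro equalityI subsetI)
    fix p assume "p \<in> to_triples F i (kpoint F (a + b * i) z)"
    then obtain x y c where "x \<in> F" "y \<in> F" "c \<in> F - {0}" "x + y * i = c * (a + b * i)"
        "p = (x, y, c * z)"
      by (auto simp: to_triples_def kpoint_def)
    then show "p \<in> hpoint F a b z"
      using coords by (auto simp: hpoint_def)
  next
    fix p assume "p \<in> hpoint F a b z"
    then obtain c where c: "c \<in> F - {0}" "p = (c * a, c * b, c * z)"
      by (auto simp: hpoint_def)
    then have "c * a + c * b * i = c * (a + b * i)"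
      using coords assms by simp
    with c show "p \<in> to_triples F i (kpoint F (a + b * i) z)"
      using assms by (auto simp: to_triples_def kpoint_def)
  qed
qed

text \<open>Scaling by \<open>a\<close> turns (u/a:1) into (u:a), and for \<open>a = 0\<close> the
  latter is the point at infinity, so one formula serves both cases.\<close>

lemma quotient_point_eq:
  assumes "a \<in> F" shows "quotient_point F u a = kpoint F u a"
proof (cases "a = 0")
  case False
  have "kpoint F (u / a) 1 = kpoint F u a"
  proof (intro equalityI subsetI)
    fix p assume "p \<in> kpoint F (u / a) 1"
    then obtain c where "c \<in> F" "c \<noteq> 0" "p = (c * (u / a), c)"
      by (auto simp: kpoint_def)
    then show "p \<in> kpoint F u a"
      using False assms unfolding kpoint_def by (auto intro!: exI[of _ "c / a"])
  next
    fix p assume "p \<in> kpoint F u a"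
    then obtain c where "c \<in> F" "c \<noteq> 0" "p = (c * u, c * a)"
      by (auto simp: kpoint_def)
    then show "p \<in> kpoint F (u / a) 1"
      using False assms unfolding kpoint_def by (auto intro!: exI[of _ "c * a"])
  qed
  with False show ?thesis
    by (simp add: quotient_point_def)
qed (simp add: quotient_point_def)

lemma to_triples_quotient_point:
  "\<lbrakk>a \<in> F; b \<in> F; z \<in> F\<rbrakk> \<Longrightarrow> to_triples F i (quotient_point F (a + b * i) z) = hpoint F a b z"
  by (simp add: quotient_point_eq to_triples_kpoint)

end

section \<open>The points \<open>u / g(u)\<close> and their image under \<open>shear\<close>\<close>

theorem theorem3p1:
  fixes F :: "'k::{field,finite} set" and m :: nat and h :: "'k poly"
    and i :: 'k and g :: "'k \<Rightarrow> 'k"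
  assumes "is_subfield F" and "card F = 2 ^ m" and "card (UNIV :: 'k set) = (card F) ^ 2"
    and "o_polynomial F h"
    and "i + i ^ card F = 1"
    and "g 1 = 1"
    and "\<And>u. u \<in> unit_circle F \<Longrightarrow> u \<noteq> 1 \<Longrightarrow>
           g u = inv_into F (poly h) (pairing F i u / pairing F 1 u) * pairing F 1 u + pairing F i u"
  shows "oval F (E_set F h) \<and> has_nucleus F (E_set F h) (hpoint F 1 0 0) \<and>
         corresponds F i g (E_set F h)"
proof -
  interpret o_poly F h
    by unfold_locales (use assms in auto)
  interpret even_quadratic_extension F m i
    by unfold_locales (use assms in auto)
  define pt where "pt u = to_triples F i (quotient_point F u (g u))" for u
  \<comment> \<open>The value \<open>g 1 = 1\<close> gives the point (1:0:1), whose image has first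
    coordinate \<open>1 + 1 = 0\<close>.\<close>
  have one: "shear ` pt 1 = hpoint F 0 1 0"
    using to_triples_quotient_point[of 1 0 1] assms(6) by (simp add: pt_def)
  \<comment> \<open>The witness \<open>s\<close> is the preimage of \<open>a / b\<close> under
    \<open>h\<close>.\<close>
  have value_g: "\<exists>s\<in>F. a = b * poly h s \<and> g (a + b * i) = s * b + a"
    if "a \<in> F" "b \<in> F" "b \<noteq> 0" "a + b * i \<in> unit_circle F" for a b
  proof -
    have "a + b * i \<noteq> 1"
      using basis_eq_iff[of a b 1 0] that by auto
    then have "g (a + b * i) = inv_into F (poly h) (a / b) * b + a"
      using assms(7)[of "a + b * i"] that by (simp add: pairing_basis)
    moreover have "a / b \<in> poly h ` F"
      using bij_h that by (simp add: bij_betw_def)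
    ultimately show ?thesis
      using that inv_into_into[of "a / b" "poly h" F] f_inv_into_f[of "a / b" "poly h" F]
      by (intro bexI[of _ "inv_into F (poly h) (a / b)"]) auto
  qed
  have shear_pt: "shear ` pt (a + b * i) = hpoint F s (poly h s) 1"
    if "a \<in> F" "b \<in> F" "b \<noteq> 0" "s \<in> F" "a = b * poly h s" "g (a + b * i) = s * b + a" for a b s
  proof -
    \<comment> \<open>The first coordinate is \<open>a + (s * b + a)\<close>, where \<open>a\<close>
      cancels; the common factor \<open>b\<close> is removed afterwards.\<close>
    have "shear ` pt (a + b * i) = hpoint F (b * s) (b * poly h s) (b * 1)"
      unfolding pt_def that(6) using that(1-4)
      by (subst to_triples_quotient_point) (auto simp: that(5) algebra_simps)
    then show ?thesis
      by (simp only: hpoint_scale[OF that(2,3)])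
  qed
  have cases: "\<exists>a\<in>F. \<exists>b\<in>F. b \<noteq> 0 \<and> u = a + b * i" if "u \<in> unit_circle F" "u \<noteq> 1" for u
  proof -
    obtain a b where "a \<in> F" "b \<in> F" "u = a + b * i"
      by (rule basis_decomposition)
    then show ?thesis
      using unit_circle_mem_F that by (cases "b = 0") auto
  qed
  have "g u \<in> F" if "u \<in> unit_circle F" for u
  proof (cases "u = 1")
    case False
    with cases that obtain a b where ab: "a \<in> F" "b \<in> F" "b \<noteq> 0" "u = a + b * i"
      by blast
    then show ?thesis
      using value_g[of a b] that by auto
  qed (simp add: assms(6))
  then have g_F: "g ` unit_circle F \<subseteq> F"
    by blast
  have "shear ` pt u \<in> E_set F h" if "u \<in> unit_circle F" for u
  proof (cases "u = 1")
    case False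
    with cases that obtain a b where ab: "a \<in> F" "b \<in> F" "b \<noteq> 0" "u = a + b * i"
      by blast
    then obtain s where s: "s \<in> F" "a = b * poly h s" "g (a + b * i) = s * b + a"
      using value_g[of a b] \<open>u \<in> unit_circle F\<close> by auto
    show ?thesis
      unfolding ab(4) shear_pt[OF ab(1-3) s] by (rule affine_mem_E[OF s(1)])
  next
    case True
    show ?thesis
      unfolding True one E_set_def by blast
  qed
  \<comment> \<open>Surjectivity onto the affine points: take \<open>u\<close> on the unit circle
    with coordinate ratio \<open>h(t)\<close>. The parameter \<open>s\<close> attached to this
    \<open>u\<close> is \<open>t\<close>, since \<open>h\<close> is injective.\<close>
  moreover have "hpoint F t (poly h t) 1 \<in> (`) shear ` pt ` unit_circle F" if t: "t \<in> F" for t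
  proof -
    obtain b where b: "b \<in> F" "b \<noteq> 0" "b * poly h t + b * i \<in> unit_circle F"
      using unit_circle_ratio_exists t h_mem by blast
    have a: "b * poly h t \<in> F"
      using b t by simp
    obtain s where s: "s \<in> F" "b * poly h t = b * poly h s"
        "g (b * poly h t + b * i) = s * b + b * poly h t"
      using value_g[OF a b] by blast
    have "poly h s = poly h t"
      using s(2) b(2) by simp
    then have "s = t"
      by (rule inj_onD[OF inj_h _ s(1) t])
    then have "shear ` pt (b * poly h t + b * i) = hpoint F t (poly h t) 1"
      using shear_pt[OF a b(1,2) s] by simp
    then show ?thesis
      using b by (metis imageI)
  qed
  moreover have "hpoint F 0 1 0 \<in> (`) shear ` pt ` unit_circle F"
    unfolding one[symmetric] by (intro imageI) (simp add: unit_circle_def conjugate_def)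
  ultimately have img: "(`) shear ` pt ` unit_circle F = E_set F h"
    unfolding E_set_def by blast
  have X: "to_triples F i ` {quotient_point F u (g u) | u. u \<in> unit_circle F} = pt ` unit_circle F"
    by (auto simp: pt_def)
  have origin: "to_triples F i (origin F) = hpoint F 0 0 1"
    using to_triples_kpoint[of 0 0 1] by (simp add: origin_def)
  note shear_collineation = inj_image_shear shear_points shear_lines
  have "oval F (pt ` unit_circle F)"
    using oval_collineation_iff[OF shear_collineation, of "pt ` unit_circle F"] oval_E_set
    by (simp only: img)
  \<comment> \<open>The origin (0:0:1) is mapped by \<open>shear\<close> to (1:0:0), the known
    nucleus of the image.\<close>
  moreover have "has_nucleus F (pt ` unit_circle F) (hpoint F 0 0 1)"
    by (rule has_nucleus_collineation[OF shear_collineation]) (simp add: img has_nucleus_E_set)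
  moreover have "projectively_equivalent F (pt ` unit_circle F) (E_set F h)"
    unfolding projectively_equivalent_def
    using semilinear_bijection_shear img by blast
  ultimately have "corresponds F i g (E_set F h)"
    unfolding corresponds_def Let_def X origin using g_F by blast
  then show ?thesis
    using oval_E_set has_nucleus_E_set by blast
qed

end
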